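(* Let $n,k\in\mathbb{Z}^+$, let $p_j$ denote the $j$-th prime, $P_{k,n}=\{p_n,\dots,p_{n+k-1}\}$ and $N=p_n p_{n+1}\cdots p_{n+k-1}$. Define the unary promise problem $\mathtt{L^{k,n}}=(\mathtt{L^{k,n}_{yes}},\mathtt{L^{k,n}_{no}})$ by $\mathtt{L^{k,n}_{yes}}=\{a^m\mid m\equiv 0\pmod N\}$ and $\mathtt{L^{k,n}_{no}}=\{a^m\mid m\bmod p_j\in[\frac{p_j}{8},\frac{3p_j}{8}]\cup[\frac{5p_j}{8},\frac{7p_j}{8}]\text{ for at least }\frac{2k}{3}\text{ different }p_j\in P_{k,n}\}$. Then there is a probabilistic finite automaton with $O(k(n+k)\log(n+k))$ states (implied constant independent of $n,k$) that solves $\mathtt{L^{k,n}}$ with one-sided error bound $\frac13$, i.e. it accepts every yes-instance with probability $1$ and accepts every no-instance with probability at most $\frac13$.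
   Context: A probabilistic finite automaton (PFA) is $(Q,\Sigma,\{A_\sigma\}_{\sigma\in\Sigma},v_0,Q_a)$ with finite state set $Q$, column-stochastic matrices $A_\sigma$, stochastic initial vector $v_0$ and accepting set $Q_a$; on input $w=w_1\cdots w_\ell$ the final vector is $v_\ell=A_{w_\ell}\cdots A_{w_1}v_0$ and the acceptance probability is $\sum_{q_j\in Q_a}v_\ell(j)$. *)

theory Defs
  imports
    Complex_Main
    "HOL-Library.Infinite_Set"
    "HOL-Computational_Algebra.Primes"
    "Jordan_Normal_Form.Matrix"
begin

definition stochastic_vec :: "real vec \<Rightarrow> bool" where
  "stochastic_vec v \<longleftrightarrow> (\<forall>i<dim_vec v. 0 \<le> v $ i) \<and> (\<Sum>i<dim_vec v. v $ i) = 1"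

definition column_stochastic :: "real mat \<Rightarrow> bool" where
  "column_stochastic A \<longleftrightarrow> (\<forall>j<dim_col A. stochastic_vec (col A j))"

text \<open>
  The finite state set \<open>Q\<close> is enumerated as \<open>{0..<num_states M}\<close>, so that matrices and
  vectors indexed by \<open>Q\<close> are those of dimension \<open>num_states M\<close>.
\<close>

record 'a pfa =
  num_states :: nat
  alphabet :: "'a set"
  trans_mat :: "'a \<Rightarrow> real mat"
  init_vec :: "real vec"
  accepting :: "nat set"

definition is_pfa :: "'a pfa \<Rightarrow> bool" where
  "is_pfa M \<longleftrightarrow>
     finite (alphabet M) \<and>
     (\<forall>\<sigma>\<in>alphabet M. trans_mat M \<sigma> \<in> carrier_mat (num_states M) (num_states M) \<and>
                     column_stochastic (trans_mat M \<sigma>)) \<and>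
     init_vec M \<in> carrier_vec (num_states M) \<and> stochastic_vec (init_vec M) \<and>
     accepting M \<subseteq> {0..<num_states M}"

definition final_vec :: "'a pfa \<Rightarrow> 'a list \<Rightarrow> real vec" where
  "final_vec M w = fold (\<lambda>\<sigma> v. trans_mat M \<sigma> *\<^sub>v v) w (init_vec M)"

definition accept_prob :: "'a pfa \<Rightarrow> 'a list \<Rightarrow> real" where
  "accept_prob M w = (\<Sum>j\<in>accepting M. final_vec M w $ j)"

text \<open>A promise problem is a pair of languages (yes-instances, no-instances).\<close>

type_synonym 'a promise_problem = "'a list set \<times> 'a list set"

definition solves_one_sided :: "'a pfa \<Rightarrow> 'a promise_problem \<Rightarrow> real \<Rightarrow> bool" where
  "solves_one_sided M L \<epsilon> \<longleftrightarrow>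
     (\<forall>w\<in>fst L. accept_prob M w = 1) \<and> (\<forall>w\<in>snd L. accept_prob M w \<le> \<epsilon>)"

text \<open>Primes are counted from one, i.e. \<open>nth_prime 1 = 2\<close>; \<open>enumerate\<close> counts from zero.\<close>

definition nth_prime :: "nat \<Rightarrow> nat" where
  "nth_prime j = enumerate {p. prime p} (j - 1)"

definition prime_block :: "nat \<Rightarrow> nat \<Rightarrow> nat set" where
  "prime_block k n = nth_prime ` {n..n + k - 1}"

definition block_prod :: "nat \<Rightarrow> nat \<Rightarrow> nat" where
  "block_prod k n = (\<Prod>j=n..n + k - 1. nth_prime j)"

definition L_yes :: "'a \<Rightarrow> nat \<Rightarrow> nat \<Rightarrow> 'a list set" where
  "L_yes a k n = {replicate m a | m. m mod block_prod k n = 0}"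

definition L_no :: "'a \<Rightarrow> nat \<Rightarrow> nat \<Rightarrow> 'a list set" where
  "L_no a k n = {replicate m a | m.
     real (card {p \<in> prime_block k n.
       real (m mod p) \<in> {real p / 8 .. 3 * real p / 8} \<union> {5 * real p / 8 .. 7 * real p / 8}})
     \<ge> 2 * real k / 3}"

definition L_problem :: "'a \<Rightarrow> nat \<Rightarrow> nat \<Rightarrow> 'a promise_problem" where
  "L_problem a k n = (L_yes a k n, L_no a k n)"

end

theory Submission imports Defs
begin

text \<open>
  The automaton picks one of the \<open>k\<close> primes uniformly at random, counts the input length modulo
  that prime and accepts iff the residue is zero. On a no-instance at least two thirds of the
  primes leave a nonzero residue. All cycles are padded to the length of the largest prime, so
  the number of states is \<open>k p\<close> with \<open>p\<close> the prime of index \<open>j = n + k - 1\<close>. The bound on \<open>p\<close> is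
  Nair's form of Chebyshev's estimate: \<open>2^(p-1) \<le> lcm(1, \<dots>, p) \<le> p^\<pi>(p) = p^j\<close>, where the
  first inequality holds because \<open>(m + 1) * (m choose i)\<close> divides \<open>lcm(1, \<dots>, m + 1)\<close> for every \<open>i\<close>.
\<close>

section \<open>Chebyshev's upper bound for the \<open>j\<close>-th prime\<close>

text \<open>
  In Leibniz's harmonic triangle, whose entries are \<open>1 / ((m + 1) * (m choose i))\<close>, each entry is the
  difference of two neighbouring ones.
\<close>

lemma Suc_times_binomial_dvd_Lcm:
  assumes "i \<le> m"
  shows "Suc m * (m choose i) dvd Lcm {1..Suc m}"
  using assms
proof (induction i arbitrary: m)
  case 0
  then show ?case by (simp add: dvd_Lcm)
next
  case (Suc i)
  then obtain l where m: "m = Suc l" and il: "i \<le> l"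
    by (cases m) auto
  let ?D = "Lcm {1..Suc m}"
  define x y z where "x = Suc l * (l choose i)" and "y = Suc m * (m choose i)"
    and "z = Suc m * (m choose Suc i)"
  have "Lcm {1..m} dvd ?D"
    by (intro Lcm_subset) auto
  then have x: "x dvd ?D"
    using Suc.IH[OF il] m x_def dvd_trans by blast
  have y: "y dvd ?D"
    using Suc.IH[of m] Suc.prems y_def by simp
  have pos: "x > 0" "y > 0" "z > 0"
    using il m by (simp_all add: x_def y_def z_def)
  have xz: "z = Suc m * (m choose Suc i)" "Suc i * (m choose Suc i) = x"
    using Suc_times_binomial_eq[of l i] m by (simp_all add: z_def x_def mult.commute)
  have xy: "(Suc l - i) * (m choose i) = x"
    using binomial_absorb_comp[of m i] il m by (simp add: x_def)
  have "Suc i * z = Suc m * x"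
    using xz by (metis mult.left_commute)
  then have 1: "real (Suc i) / real x = real (Suc m) / real z"
    using pos by (simp add: field_simps flip: of_nat_mult)
  have "(Suc l - i) * y = Suc m * x"
    using xy y_def by (metis mult.left_commute)
  then have "real (Suc l - i) * real y = real (Suc m) * real x"
    by (metis of_nat_mult)
  then have 2: "real (Suc l - i) / real x = real (Suc m) / real y"
    using pos by (simp add: frac_eq_eq)
  have 3: "real (Suc i) + real (Suc l - i) = real (Suc m)"
    using il m by simp
  \<comment> \<open>The numerators in \<open>1\<close> and \<open>2\<close> add up to
    \<open>Suc m\<close>, which turns the two proportions into the triangle relation
    \<open>1 / x = 1 / z + 1 / y\<close>.\<close>
  have "real (Suc m) / real x = real (Suc m) * (1 / real z + 1 / real y)"
    using 1 2 3 by (metis add_divide_distrib distrib_left times_divide_eq_right mult.right_neutral)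
  then have "1 / real x = 1 / real z + 1 / real y"
    by (metis divide_inverse mult_cancel_left mult_1 nat.simps(3) of_nat_eq_0_iff)
  then have "real ?D / real z = real ?D / real x - real ?D / real y"
    by (simp add: divide_inverse algebra_simps)
  moreover have "real ?D / real x \<in> \<int>" "real ?D / real y \<in> \<int>"
    using x y by (metis Ints_of_nat real_of_nat_div)+
  ultimately have "real ?D / real z \<in> \<int>"
    by (metis Ints_diff)
  then have "z dvd ?D"
    using pos by (metis of_nat_dvd_iff of_int_of_nat_eq of_int_div_of_int_in_Ints_iff of_nat_eq_0_iff
        less_numeral_extra(3))
  then show ?case
    by (simp add: z_def)
qed

text \<open>Replacing every coefficient in row \<open>m\<close> by the central one gives exactly the
  product that divides the lcm.\<close>

lemma two_power_le_Lcm: "2 ^ m \<le> (Lcm {1..Suc m} :: nat)"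
proof -
  have "(2::nat) ^ m = (\<Sum>i\<le>m. m choose i)"
    by (simp add: choose_row_sum)
  also have "\<dots> \<le> (\<Sum>i\<le>m. m choose (m div 2))"
    by (intro sum_mono binomial_maximum)
  also have "\<dots> = Suc m * (m choose (m div 2))"
    by simp
  also have "\<dots> \<le> Lcm {1..Suc m}"
    using Suc_times_binomial_dvd_Lcm[of "m div 2" m] by (intro dvd_imp_le) (auto intro!: Nat.gr0I)
  finally show ?thesis .
qed

text \<open>The lcm divides the product, over the primes up to \<open>N\<close>, of the largest
  prime powers not exceeding \<open>N\<close>; each of these factors is at most
  \<open>N\<close>.\<close>

lemma Lcm_le_power_card_primes:
  assumes "N \<ge> 1"
  shows "Lcm {1..N} \<le> N ^ card {p::nat. prime p \<and> p \<le> N}"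
proof -
  let ?P = "{p::nat. prime p \<and> p \<le> N}"
  define e where "e p = (GREATEST e. p ^ e \<le> N)" for p
  have fin: "finite ?P"
    by simp
  \<comment> \<open>Bounds the admissible exponents, so that \<open>GREATEST\<close> in
    \<open>e\<close> denotes a true maximum.\<close>
  have bound: "i \<le> N" if "prime p" "p ^ i \<le> N" for p i :: nat
  proof -
    have "i \<le> 2 ^ i"
      using less_exp[of i] by simp
    also have "\<dots> \<le> p ^ i"
      using prime_ge_2_nat[OF that(1)] by (intro power_mono) auto
    finally show ?thesis
      using that(2) by simp
  qed
  have e_le: "p ^ e p \<le> N" if "prime p" for p
    unfolding e_def using bound[OF that] assms by (intro GreatestI_nat[of "\<lambda>e. p ^ e \<le> N" 0 N]) auto
  have e_ge: "i \<le> e p" if "prime p" "p ^ i \<le> N" for p i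
    unfolding e_def using bound[OF that(1)] that(2) by (intro Greatest_le_nat[of "\<lambda>e. p ^ e \<le> N" i N]) auto
  have "i dvd (\<Prod>p\<in>?P. p ^ e p)" if i: "i \<in> {1..N}" for i
  proof -
    have le: "p ^ multiplicity p i \<le> N" for p
      using i dvd_imp_le[OF multiplicity_dvd[of p i]] by simp
    have "i = (\<Prod>p\<in>prime_factors i. p ^ multiplicity p i)"
      using i by (simp add: prime_factorization_nat)
    also have "\<dots> dvd (\<Prod>p\<in>?P. p ^ e p)"
    proof (intro prod_dvd_prod_subset2 fin)
      show "prime_factors i \<subseteq> ?P"
        using i by (auto dest!: dvd_imp_le simp: in_prime_factors_iff)
    qed (use le e_ge in \<open>auto intro!: le_imp_power_dvd simp: in_prime_factors_iff\<close>)
    finally show ?thesis .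
  qed
  then have "Lcm {1..N} dvd (\<Prod>p\<in>?P. p ^ e p)"
    by (intro Lcm_least)
  then have "Lcm {1..N} \<le> (\<Prod>p\<in>?P. p ^ e p)"
    by (intro dvd_imp_le prod_pos) (auto simp: prime_gt_0_nat)
  also have "\<dots> \<le> (\<Prod>p\<in>?P. N)"
    using e_le by (intro prod_mono) auto
  finally show ?thesis
    by simp
qed

section \<open>From the lcm bounds to the enumerated primes\<close>

lemma prime_nth_prime: "prime (nth_prime j)"
  using enumerate_in_set[OF primes_infinite, of "j - 1"] by (simp add: nth_prime_def)

text \<open>The domain starts at 1 because truncated subtraction makes \<open>nth_prime 0\<close>
  and \<open>nth_prime 1\<close> coincide.\<close>

lemma nth_prime_strict_mono_on: "strict_mono_on {1..} nth_prime"
  using enumerate_mono[OF _ primes_infinite] by (auto intro!: strict_mono_onI simp: nth_prime_def)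

lemma card_primes_le_nth_prime:
  assumes "j \<ge> 1"
  shows "card {p. prime p \<and> p \<le> nth_prime j} \<le> j"
proof -
  let ?e = "enumerate {p::nat. prime p}"
  have "{p. prime p \<and> p \<le> nth_prime j} \<subseteq> ?e ` {..<j}"
  proof
    fix p assume "p \<in> {p. prime p \<and> p \<le> nth_prime j}"
    then have p: "prime p" "p \<le> ?e (j - 1)"
      by (auto simp: nth_prime_def)
    obtain i where "?e i = p"
      using enumerate_Ex[OF primes_infinite, of p] p(1) by auto
    with p(2) show "p \<in> ?e ` {..<j}"
      using enumerate_mono[OF _ primes_infinite, of "j - 1" i] assms
      by (metis Suc_pred' image_eqI leD lessThan_iff less_Suc_eq_le less_eq_Suc_le not_le One_nat_def)
  qed
  then have "card {p. prime p \<and> p \<le> nth_prime j} \<le> card (?e ` {..<j})"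
    by (intro card_mono) auto
  also have "\<dots> \<le> j"
    using card_image_le[of "{..<j}" ?e] by simp
  finally show ?thesis .
qed

lemma two_power_le_nth_prime_power:
  assumes "j \<ge> 1"
  shows "2 ^ (nth_prime j - 1) \<le> nth_prime j ^ j"
proof -
  let ?p = "nth_prime j"
  have p: "?p \<ge> 1"
    using prime_ge_1_nat[OF prime_nth_prime] .
  then have "2 ^ (?p - 1) \<le> Lcm {1..?p}"
    using two_power_le_Lcm[of "?p - 1"] by simp
  also have "\<dots> \<le> ?p ^ card {p. prime p \<and> p \<le> ?p}"
    using p by (rule Lcm_le_power_card_primes)
  also have "\<dots> \<le> ?p ^ j"
    using p card_primes_le_nth_prime[OF assms] by (intro power_increasing)
  finally show ?thesis .
qed

text \<open>Bootstrapping from \<open>(p - 1) * ln 2 \<le> j * ln p\<close>: a crude estimate of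
  \<open>ln p\<close> yields \<open>p \<le> (4 * j)^2\<close>, hence
  \<open>ln p \<le> 6 * ln (j + 1)\<close>, and inserting this gives the sharper bound. Using
  \<open>j + 1\<close> keeps the logarithm positive at \<open>j = 1\<close>.\<close>

lemma nth_prime_upper_bound:
  assumes "j \<ge> 1"
  shows "real (nth_prime j) \<le> 16 * (real (j + 1) * ln (real (j + 1)))"
proof -
  define p where "p = real (nth_prime j)"
  define s where "s = sqrt p"
  define L where "L = ln (real (j + 1))"
  have p: "p > 1"
    using prime_gt_1_nat[OF prime_nth_prime, of j] by (simp add: p_def)
  have s: "s > 1" "p = s ^ 2"
    using p by (simp_all add: s_def)
  have ln2: "ln 2 \<ge> (1/2::real)"
    using ln_le_minus_one[of "1/2 :: real"] by (simp add: ln_div)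
  have "(2::real) ^ (nth_prime j - 1) \<le> p ^ j"
    using two_power_le_nth_prime_power[OF assms] unfolding p_def
    by (metis of_nat_le_iff of_nat_numeral of_nat_power)
  then have "ln ((2::real) ^ (nth_prime j - 1)) \<le> ln (p ^ j)"
    using p by (intro ln_mono) auto
  then have main: "(p - 1) * ln 2 \<le> real j * ln p"
    using p by (simp add: ln_realpow p_def of_nat_diff)
  have "ln p = 2 * ln s"
    using s by (simp add: ln_realpow)
  also have "\<dots> \<le> 2 * (s - 1)"
    using ln_le_minus_one[of s] s by simp
  finally have "real j * ln p \<le> real j * (2 * (s - 1))"
    by (intro mult_left_mono) auto
  moreover have "(p - 1) * (1/2) \<le> (p - 1) * ln 2"
    using ln2 p by (intro mult_left_mono) auto
  \<comment> \<open>Since \<open>p - 1 = (s - 1) * (s + 1)\<close>, the positive factor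
    \<open>s - 1\<close> cancels.\<close>
  ultimately have "(s - 1) * ((s + 1) * (1/2)) \<le> (s - 1) * (2 * real j)"
    using main s by (simp add: power2_eq_square algebra_simps)
  then have "s \<le> 4 * real j"
    using s by simp
  then have "p \<le> (4 * real j) ^ 2"
    using s power_mono[of s "4 * real j" 2] by simp
  also have "\<dots> \<le> 2 ^ 4 * real (j + 1) ^ 2"
    by (simp add: power2_eq_square algebra_simps)
  \<comment> \<open>As \<open>2 \<le> j + 1\<close>, the constant is absorbed into a pure power,
    whose logarithm is a multiple of \<open>L\<close>.\<close>
  also have "\<dots> \<le> real (j + 1) ^ 4 * real (j + 1) ^ 2"
    using assms by (intro mult_right_mono power_mono) auto
  also have "\<dots> = real (j + 1) ^ 6"
    by (simp flip: power_add)
  finally have "ln p \<le> ln (real (j + 1) ^ 6)"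
    using p by (intro ln_mono) auto
  then have lnp: "ln p \<le> 6 * L"
    unfolding L_def by (subst (asm) ln_realpow) auto
  have L: "L \<ge> 1/2"
    using ln2 assms ln_mono[of 2 "real (j + 1)"] unfolding L_def by linarith
  have "(p - 1) * (1/2) \<le> real j * (6 * L)"
    using \<open>(p - 1) * (1/2) \<le> (p - 1) * ln 2\<close> main mult_left_mono[OF lnp, of "real j"] by linarith
  then have "p \<le> 1 + 12 * (real j * L)"
    by simp
  \<comment> \<open>The lone 1 is absorbed by \<open>L \<ge> 1/2\<close>, so that the sum becomes a
    multiple of \<open>(j + 1) * L\<close>.\<close>
  also have "\<dots> \<le> 16 * L + 16 * (real j * L)"
    using L by (intro add_mono mult_right_mono) auto
  finally show ?thesis
    by (simp add: p_def L_def algebra_simps)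
qed

section \<open>Deterministic transitions with a uniform initial distribution\<close>

definition fun_mat :: "nat \<Rightarrow> (nat \<Rightarrow> nat) \<Rightarrow> real mat" where
  "fun_mat S f = mat S S (\<lambda>(i, j). if i = f j then 1 else 0)"

definition uniform_vec :: "nat \<Rightarrow> nat set \<Rightarrow> real vec" where
  "uniform_vec S B = vec S (\<lambda>i. if i \<in> B then 1 / real (card B) else 0)"

text \<open>All randomness sits in the initial vector. \<open>B\<close> is both its support and the
  accepting set, because a run starts at residue zero and accepts when it is back at residue
  zero.\<close>

definition fun_pfa :: "'a \<Rightarrow> nat \<Rightarrow> (nat \<Rightarrow> nat) \<Rightarrow> nat set \<Rightarrow> 'a pfa" where
  "fun_pfa a S f B = \<lparr>num_states = S, alphabet = {a}, trans_mat = (\<lambda>_. fun_mat S f),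
     init_vec = uniform_vec S B, accepting = B\<rparr>"

lemma stochastic_uniform_vec:
  assumes "B \<subseteq> {..<S}" "B \<noteq> {}"
  shows "stochastic_vec (uniform_vec S B)"
proof -
  have "finite B"
    using assms(1) finite_subset by blast
  then have "(\<Sum>i\<in>B. 1 / real (card B)) = 1"
    using assms(2) by simp
  then show ?thesis
    using assms(1) by (simp add: stochastic_vec_def uniform_vec_def sum.If_cases Int_absorb1)
qed

lemma column_stochastic_fun_mat:
  assumes "\<And>j. j < S \<Longrightarrow> f j < S"
  shows "column_stochastic (fun_mat S f)"
  using assms by (auto simp: column_stochastic_def stochastic_vec_def fun_mat_def)

lemma is_pfa_fun_pfa:
  assumes "\<And>j. j < S \<Longrightarrow> f j < S" "B \<subseteq> {..<S}" "B \<noteq> {}"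
  shows "is_pfa (fun_pfa a S f B)"
  using assms stochastic_uniform_vec[OF assms(2,3)] column_stochastic_fun_mat[OF assms(1)]
  by (auto simp: is_pfa_def fun_pfa_def fun_mat_def uniform_vec_def)

lemma fun_mat_mult_vec:
  assumes "v \<in> carrier_vec S" "i < S"
  shows "(fun_mat S f *\<^sub>v v) $ i = (\<Sum>j | j < S \<and> f j = i. v $ j)"
proof -
  have "(fun_mat S f *\<^sub>v v) $ i = (\<Sum>j<S. if f j = i then v $ j else 0)"
    using assms by (auto simp: fun_mat_def scalar_prod_def lessThan_atLeast0 intro!: sum.cong)
  then show ?thesis
    by (simp add: sum.If_cases Collect_conj_eq lessThan_def)
qed

text \<open>The final vector is the push-forward of the initial distribution under the
  \<open>m\<close>-th iterate of \<open>f\<close>; the induction step groups start states by their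
  position after \<open>m\<close> letters.\<close>

lemma final_vec_fun_pfa:
  assumes f: "\<And>j. j < S \<Longrightarrow> f j < S"
  shows "final_vec (fun_pfa a S f B) (replicate m a) =
    vec S (\<lambda>i. \<Sum>j | j < S \<and> (f ^^ m) j = i. uniform_vec S B $ j)"
proof (induction m)
  case 0
  have "{j. j < S \<and> j = i} = {i}" if "i < S" for i
    using that by auto
  then show ?case
    by (auto simp: final_vec_def fun_pfa_def uniform_vec_def)
next
  case (Suc m)
  let ?u = "\<lambda>j. uniform_vec S B $ j"
  let ?v = "vec S (\<lambda>i. \<Sum>j | j < S \<and> (f ^^ m) j = i. ?u j)"
  have iter: "(f ^^ m) j < S" if "j < S" for j
    using that f by (induction m) auto
  have "final_vec (fun_pfa a S f B) (replicate (Suc m) a) = fun_mat S f *\<^sub>v ?v"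
    using Suc.IH by (simp add: final_vec_def fun_pfa_def replicate_append_same flip: replicate_append_same)
  also have "\<dots> = vec S (\<lambda>i. \<Sum>j | j < S \<and> (f ^^ Suc m) j = i. ?u j)"
  proof (rule eq_vecI)
    fix i assume "i < dim_vec (vec S (\<lambda>i. \<Sum>j | j < S \<and> (f ^^ Suc m) j = i. ?u j))"
    then have i: "i < S"
      by simp
    have "(fun_mat S f *\<^sub>v ?v) $ i =
        (\<Sum>l | l < S \<and> f l = i. \<Sum>j | j < S \<and> (f ^^ m) j = l. ?u j)"
      using i by (subst fun_mat_mult_vec) auto
    also have "\<dots> = (\<Sum>l | l < S \<and> f l = i.
        \<Sum>j\<in>{j \<in> {j. j < S \<and> (f ^^ Suc m) j = i}. (f ^^ m) j = l}. ?u j)"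
      by (intro sum.cong) auto
    also have "\<dots> = (\<Sum>j | j < S \<and> (f ^^ Suc m) j = i. ?u j)"
      using iter by (intro sum.group) auto
    finally show "(fun_mat S f *\<^sub>v ?v) $ i =
        vec S (\<lambda>i. \<Sum>j | j < S \<and> (f ^^ Suc m) j = i. ?u j) $ i"
      using i by simp
  qed (simp add: fun_mat_def)
  finally show ?case .
qed

text \<open>Runs are deterministic once started and every start state has the same weight, so
  acceptance reduces to counting.\<close>

lemma accept_prob_fun_pfa:
  assumes f: "\<And>j. j < S \<Longrightarrow> f j < S" and B: "B \<subseteq> {..<S}"
  shows "accept_prob (fun_pfa a S f B) (replicate m a) =
    real (card {j \<in> B. (f ^^ m) j \<in> B}) / real (card B)"
proof -
  let ?u = "\<lambda>j. uniform_vec S B $ j"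
  have fin: "finite B"
    using B finite_subset by blast
  have accepting: "accepting (fun_pfa a S f B) = B"
    by (simp add: fun_pfa_def)
  have final_vec: "final_vec (fun_pfa a S f B) (replicate m a) =
      vec S (\<lambda>i. \<Sum>j | j < S \<and> (f ^^ m) j = i. ?u j)"
    using f by (rule final_vec_fun_pfa)
  have "accept_prob (fun_pfa a S f B) (replicate m a) =
      (\<Sum>i\<in>B. \<Sum>j | j < S \<and> (f ^^ m) j = i. ?u j)"
    using B unfolding accept_prob_def final_vec accepting by (intro sum.cong) auto
  also have "\<dots> = (\<Sum>i\<in>B. \<Sum>j\<in>{j \<in> {j. j < S \<and> (f ^^ m) j \<in> B}. (f ^^ m) j = i}. ?u j)"
    by (intro sum.cong) auto
  also have "\<dots> = (\<Sum>j | j < S \<and> (f ^^ m) j \<in> B. ?u j)"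
    using fin by (intro sum.group) auto
  also have "\<dots> = (\<Sum>j\<in>{j \<in> B. (f ^^ m) j \<in> B}. 1 / real (card B))"
    using B by (intro sum.mono_neutral_cong_right) (auto simp: uniform_vec_def)
  finally show ?thesis
    by simp
qed

section \<open>Random choice of a modulus\<close>

text \<open>State \<open>i * P + r\<close> means that modulus \<open>q i\<close> was chosen and the current residue is \<open>r\<close>.\<close>

definition cycle_step :: "nat \<Rightarrow> (nat \<Rightarrow> nat) \<Rightarrow> nat \<Rightarrow> nat" where
  "cycle_step P q s = (s div P) * P + Suc (s mod P) mod q (s div P)"

text \<open>The start and accepting states are \<open>i * P\<close>. The run from
  \<open>i * P\<close> reaches \<open>i * P + m mod q i\<close> after \<open>m\<close> letters, so
  it accepts iff \<open>q i\<close> divides \<open>m\<close>.\<close>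

lemma ex_pfa_random_modulus:
  fixes q :: "nat \<Rightarrow> nat"
  assumes k: "k \<ge> 1" and q: "\<And>i. i < k \<Longrightarrow> 0 < q i \<and> q i \<le> P"
  shows "\<exists>M :: 'a pfa. is_pfa M \<and> alphabet M = {a} \<and> num_states M = k * P \<and>
    (\<forall>m. accept_prob M (replicate m a) = real (card {i. i < k \<and> q i dvd m}) / real k)"
proof -
  let ?f = "cycle_step P q"
  define B where "B = (\<lambda>i. i * P) ` {..<k}"
  have P: "P > 0"
    using q[of 0] k by linarith
  \<comment> \<open>Stated for arbitrary \<open>r\<close> so that it also covers padding states,
    whose residue part is at least \<open>q i\<close>.\<close>
  have small: "r mod q i < P" if "i < k" for r i
    using q[OF that] by (meson mod_less_divisor order_less_le_trans)
  have enc: "i * P + r < k * P" if "i < k" "r < P" for i r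
  proof -
    have "i * P + r < Suc i * P"
      using that(2) by simp
    also have "\<dots> \<le> k * P"
      using that(1) by (intro mult_le_mono1) simp
    finally show ?thesis .
  qed
  have f: "?f s < k * P" if "s < k * P" for s
    using that small enc less_mult_imp_div_less by (auto simp: cycle_step_def)
  have B: "B \<subseteq> {..<k * P}" "B \<noteq> {}"
    using P k by (auto simp: B_def lessThan_empty_iff)
  have inj: "inj_on (\<lambda>i. i * P) A" for A
    using P by (auto intro: inj_onI)
  have card_B: "card B = k"
    by (simp add: B_def card_image[OF inj])
  have iter: "(?f ^^ m) (i * P) = i * P + m mod q i" if "i < k" for m i
  proof (induction m)
    case (Suc m)
    then show ?case
      using P small[OF that, of m] by (simp add: cycle_step_def mod_Suc_eq)
  qed simp
  have "i * P + m mod q i \<in> B \<longleftrightarrow> q i dvd m" if "i < k" for i m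
  proof
    assume "i * P + m mod q i \<in> B"
    then obtain l where "i * P + m mod q i = l * P"
      by (auto simp: B_def)
    \<comment> \<open>Reducing modulo \<open>P\<close> isolates the residue, which is smaller than
      \<open>P\<close>.\<close>
    then have "(i * P + m mod q i) mod P = 0"
      by (metis mod_mult_self2_is_0)
    then show "q i dvd m"
      using small[OF that, of m] by (simp add: mod_eq_0_iff_dvd)
  qed (use that in \<open>auto simp: B_def\<close>)
  then have "(?f ^^ m) (i * P) \<in> B \<longleftrightarrow> q i dvd m" if "i < k" for i m
    using iter that by metis
  then have "{i \<in> {..<k}. (?f ^^ m) (i * P) \<in> B} = {i. i < k \<and> q i dvd m}" for m
    by auto
  then have "{j \<in> B. (?f ^^ m) j \<in> B} = (\<lambda>i. i * P) ` {i. i < k \<and> q i dvd m}" for m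
    using Compr_image_eq[of "\<lambda>i. i * P" "{..<k}" "\<lambda>j. (?f ^^ m) j \<in> B"]
    unfolding B_def[symmetric] by simp
  then have "accept_prob (fun_pfa a (k * P) ?f B) (replicate m a) =
      real (card {i. i < k \<and> q i dvd m}) / real k" for m
    using accept_prob_fun_pfa[of _ ?f, OF f B(1)] by (simp add: card_image[OF inj] card_B)
  then show ?thesis
    using is_pfa_fun_pfa[of _ ?f, OF f B] by (intro exI[of _ "fun_pfa a (k * P) ?f B"]) (simp add: fun_pfa_def)
qed

section \<open>Application to the block of consecutive primes\<close>

text \<open>The acceptance probability counts indices while the promise counts primes; this
  identifies the two counts.\<close>

lemma bij_betw_prime_block:
  assumes "n \<ge> 1" "k \<ge> 1"
  shows "bij_betw (\<lambda>i. nth_prime (n + i)) {..<k} (prime_block k n)"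
proof -
  have "{n..n + k - 1} = (+) n ` {..<k}"
    using assms by (simp add: lessThan_atLeast0 add.commute atLeastLessThanSuc_atLeastAtMost[symmetric])
  then have "(\<lambda>i. nth_prime (n + i)) ` {..<k} = prime_block k n"
    by (simp add: prime_block_def image_image)
  moreover have "inj_on (\<lambda>i. nth_prime (n + i)) {..<k}"
    using strict_mono_on_imp_inj_on[OF nth_prime_strict_mono_on] assms(1) by (fastforce simp: inj_on_def)
  ultimately show ?thesis
    by (simp add: bij_betw_def)
qed

theorem theorem8:
  fixes a :: 'a
  shows "\<exists>C::real. \<forall>n k :: nat. n \<ge> 1 \<longrightarrow> k \<ge> 1 \<longrightarrow>
    (\<exists>M :: 'a pfa. is_pfa M \<and> alphabet M = {a} \<and>
       real (num_states M) \<le> C * (real k * real (n + k) * ln (real (n + k))) \<and>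
       solves_one_sided M (L_problem a k n) (1 / 3))"
proof (intro exI[of _ 16] allI impI)
  fix n k :: nat
  assume n: "n \<ge> 1" and k: "k \<ge> 1"
  let ?q = "\<lambda>i. nth_prime (n + i)"
  let ?P = "nth_prime (n + k - 1)"
  note bij = bij_betw_prime_block[OF n k]
  have "0 < ?q i \<and> ?q i \<le> ?P" if "i < k" for i
    using that n strict_mono_on_leD[OF nth_prime_strict_mono_on, of "n + i" "n + k - 1"]
      prime_gt_0_nat[OF prime_nth_prime] by auto
  then obtain M :: "'a pfa" where M: "is_pfa M" "alphabet M = {a}" "num_states M = k * ?P"
    and acc: "\<And>m. accept_prob M (replicate m a) = real (card {i. i < k \<and> ?q i dvd m}) / real k"
    using ex_pfa_random_modulus[OF k, of ?q ?P a] by blast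
  \<comment> \<open>For the index \<open>j = n + k - 1\<close> of the largest prime,
    \<open>j + 1\<close> is exactly \<open>n + k\<close>.\<close>
  have "real ?P \<le> 16 * (real (n + k) * ln (real (n + k)))"
    using nth_prime_upper_bound[of "n + k - 1"] n k by simp
  then have "real k * real ?P \<le> real k * (16 * (real (n + k) * ln (real (n + k))))"
    by (intro mult_left_mono) auto
  then have states: "real (num_states M) \<le> 16 * (real k * real (n + k) * ln (real (n + k)))"
    using M(3) by (simp add: algebra_simps)
  have yes: "accept_prob M w = 1" if w: "w \<in> L_yes a k n" for w
  proof -
    obtain m where w: "w = replicate m a" and m: "block_prod k n dvd m"
      using w by (auto simp: L_yes_def mod_eq_0_iff_dvd)
    have "?q i dvd block_prod k n" if "i < k" for i
      unfolding block_prod_def using that by (intro dvd_prodI) auto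
    then have "{i. i < k \<and> ?q i dvd m} = {..<k}"
      using m dvd_trans by blast
    then show ?thesis
      using acc k w by simp
  qed
  have no: "accept_prob M w \<le> 1 / 3" if w: "w \<in> L_no a k n" for w
  proof -
    obtain m where w: "w = replicate m a" and m: "2 * real k / 3 \<le> real (card {p \<in> prime_block k n.
       real (m mod p) \<in> {real p / 8 .. 3 * real p / 8} \<union> {5 * real p / 8 .. 7 * real p / 8}})"
      (is "_ \<le> real (card ?T)")
      using w by (auto simp: L_no_def)
    let ?Z = "{p \<in> prime_block k n. p dvd m}"
    have fin: "finite (prime_block k n)" and card: "card (prime_block k n) = k"
      using bij_betw_finite[OF bij] bij_betw_same_card[OF bij] by simp_all
    have "p > 0" if "p \<in> prime_block k n" for p
      using that prime_gt_0_nat[OF prime_nth_prime] by (auto simp: prime_block_def)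
    \<comment> \<open>Both intervals lie above zero, so no prime counted in \<open>?T\<close>
      divides \<open>m\<close>; this leaves at most \<open>k / 3\<close> primes in
      \<open>?Z\<close>.\<close>
    then have "?Z \<inter> ?T = {}"
      by (fastforce simp: dvd_eq_mod_eq_0)
    then have "card ?Z + card ?T = card (?Z \<union> ?T)"
      using fin by (simp add: card_Un_disjoint)
    also have "\<dots> \<le> k"
      using card_mono[OF fin, of "?Z \<union> ?T"] card by auto
    finally have "real (card ?Z) \<le> real k / 3"
      using m by linarith
    moreover have "bij_betw ?q {i. i < k \<and> ?q i dvd m} ?Z"
      using bij by (auto simp: bij_betw_def inj_on_def)
    then have "card {i. i < k \<and> ?q i dvd m} = card ?Z"
      by (rule bij_betw_same_card)
    ultimately show ?thesis
      using acc[of m] k w by (simp add: divide_le_eq)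
  qed
  show "\<exists>M :: 'a pfa. is_pfa M \<and> alphabet M = {a} \<and>
       real (num_states M) \<le> 16 * (real k * real (n + k) * ln (real (n + k))) \<and>
       solves_one_sided M (L_problem a k n) (1 / 3)"
    using M(1,2) states yes no by (auto simp: solves_one_sided_def L_problem_def)
qed

end
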